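(* Let $(\mathcal{P},\mathcal{H})$ be an intersection-closed hypothesis space whose collection $\{H_P:P\in\mathcal{P}\}$ of least hypotheses is at most countable. Let $\varepsilon_0:\mathcal{H}\to[0,\infty]$ be an E-capacity and $\varepsilon_1:\mathcal{H}\times\mathcal{X}\to[0,\infty]$ a valid E-capacity kernel. For each $x\in\mathcal{X}$ let $\varepsilon_2(\cdot\mid x)$ be the closure of the map $H\mapsto\varepsilon_0(H)\,\varepsilon_1(H\mid x)$. Then $\varepsilon_2$ is an E-measure kernel that satisfies $$\mathbb{E}^P[\varepsilon_2(H\mid X)]\le\varepsilon_0(H_P)\quad\text{for every nonempty }H\in\mathcal{H}\text{ and every }P\in H.$$
   Context: $(\mathcal{X},\Sigma)$ is a measurable space and $\mathcal{P}$ a collection of probability measures on it; $\mathbb{E}^P$ is expectation when $X\in\mathcal{X}$ has law $P$. A hypothesis class $\mathcal{H}$ is a collection of subsets of $\mathcal{P}$ closed under arbitrary unions (including the empty union, so $\emptyset\in\mathcal{H}$); $(\mathcal{P},\mathcal{H})$ is then a hypothesis space. It is intersection-closed if $\mathcal{H}$ is also closed under arbitrary intersections and $\mathcal{P}\in\mathcal{H}$. In that case the least hypothesis of $P\in\mathcal{P}$ is $H_P=\bigcap\{H\in\mathcal{H}:P\in H\}\in\mathcal{H}$. An E-function is a map $\varepsilon:\mathcal{H}\to[0,\infty]$ with $\varepsilon(\emptyset)=\infty$. An E-capacity is an E-function with $\varepsilon(H')\le\varepsilon(H)$ whenever $H\subseteq H'$, $H,H'\in\mathcal{H}$. An E-measure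 is a map $\varepsilon:\mathcal{H}\to[0,\infty]$ with $\varepsilon(\bigcup_{H\in\mathcal{S}}H)=\inf_{H\in\mathcal{S}}\varepsilon(H)$ for every $\mathcal{S}\subseteq\mathcal{H}$ (with $\inf\emptyset=\infty$). The closure of an E-function $\varepsilon$ is $$\overline{\varepsilon}(H)=\sup_{\mathcal{T}}\inf_{H'\in\mathcal{T}}\varepsilon(H'),$$ where the supremum is over all $\mathcal{T}\subseteq\mathcal{H}$ with $H\subseteq\bigcup_{H'\in\mathcal{T}}H'$. Convention: $0\cdot\infty=\infty\cdot0=0$. An E-capacity kernel (resp. E-measure kernel) is a map $\varepsilon:\mathcal{H}\times\mathcal{X}\to[0,\infty]$, written $\varepsilon(H\mid x)$, such that $x\mapsto\varepsilon(H\mid x)$ is $\Sigma$-measurable for every $H\in\mathcal{H}$ and $H\mapsto\varepsilon(H\mid x)$ is an E-capacity (resp. E-measure) for every $x\in\mathcal{X}$. It is valid if $\mathbb{E}^P[\varepsilon(H\mid X)]\le1$ for every nonempty $H\in\mathcal{H}$ and every $P\in H$. *)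

theory Defs
  imports "HOL-Probability.Probability"
begin

text \<open>
  The measure \<open>M\<close> only serves to represent the measurable space
  \<open>(space M, sets M)\<close>; its \<open>emeasure\<close> is never used.  Set functions on a hypothesis
  class \<open>\<H>\<close> are total functions that are constrained on members of \<open>\<H>\<close> only.
\<close>

definition hypothesis_space ::
  "'a measure \<Rightarrow> 'a measure set \<Rightarrow> 'a measure set set \<Rightarrow> bool" where
  "hypothesis_space M \<P> \<H> \<longleftrightarrow>
     (\<forall>P\<in>\<P>. prob_space P \<and> sets P = sets M) \<and>
     (\<forall>H\<in>\<H>. H \<subseteq> \<P>) \<and>
     (\<forall>\<S>. \<S> \<subseteq> \<H> \<longrightarrow> \<Union>\<S> \<in> \<H>)"

text \<open>In HOL \<open>\<Inter>{}\<close> is \<open>UNIV\<close>; the empty intersection, taken inside \<open>\<P>\<close>,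
  is covered by \<open>\<P> \<in> \<H>\<close>.\<close>

definition intersection_closed :: "'a measure set \<Rightarrow> 'a measure set set \<Rightarrow> bool" where
  "intersection_closed \<P> \<H> \<longleftrightarrow>
     (\<forall>\<S>. \<S> \<subseteq> \<H> \<and> \<S> \<noteq> {} \<longrightarrow> \<Inter>\<S> \<in> \<H>) \<and> \<P> \<in> \<H>"

definition least_hypothesis :: "'a measure set set \<Rightarrow> 'a measure \<Rightarrow> 'a measure set" where
  "least_hypothesis \<H> P = \<Inter>{H \<in> \<H>. P \<in> H}"

text \<open>An E-function is constrained only at \<open>{}\<close>, which belongs to every hypothesis class.\<close>

definition E_function :: "('a measure set \<Rightarrow> ennreal) \<Rightarrow> bool" where
  "E_function \<epsilon> \<longleftrightarrow> \<epsilon> {} = \<infinity>"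

definition E_capacity ::
  "'a measure set set \<Rightarrow> ('a measure set \<Rightarrow> ennreal) \<Rightarrow> bool" where
  "E_capacity \<H> \<epsilon> \<longleftrightarrow>
     E_function \<epsilon> \<and> (\<forall>H\<in>\<H>. \<forall>H'\<in>\<H>. H \<subseteq> H' \<longrightarrow> \<epsilon> H' \<le> \<epsilon> H)"

text \<open>In \<open>ennreal\<close> the infimum of the empty set is \<open>\<infinity>\<close>.\<close>

definition E_measure ::
  "'a measure set set \<Rightarrow> ('a measure set \<Rightarrow> ennreal) \<Rightarrow> bool" where
  "E_measure \<H> \<epsilon> \<longleftrightarrow> (\<forall>\<S>. \<S> \<subseteq> \<H> \<longrightarrow> \<epsilon> (\<Union>\<S>) = (INF H\<in>\<S>. \<epsilon> H))"

definition E_closure ::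
  "'a measure set set \<Rightarrow> ('a measure set \<Rightarrow> ennreal) \<Rightarrow> 'a measure set \<Rightarrow> ennreal" where
  "E_closure \<H> \<epsilon> H = (SUP \<T> \<in> {\<T>. \<T> \<subseteq> \<H> \<and> H \<subseteq> \<Union>\<T>}. INF H'\<in>\<T>. \<epsilon> H')"

definition E_capacity_kernel ::
  "'a measure \<Rightarrow> 'a measure set set \<Rightarrow> ('a measure set \<Rightarrow> 'a \<Rightarrow> ennreal) \<Rightarrow> bool" where
  "E_capacity_kernel M \<H> \<epsilon> \<longleftrightarrow>
     (\<forall>H\<in>\<H>. (\<lambda>x. \<epsilon> H x) \<in> borel_measurable M) \<and>
     (\<forall>x\<in>space M. E_capacity \<H> (\<lambda>H. \<epsilon> H x))"

definition E_measure_kernel ::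
  "'a measure \<Rightarrow> 'a measure set set \<Rightarrow> ('a measure set \<Rightarrow> 'a \<Rightarrow> ennreal) \<Rightarrow> bool" where
  "E_measure_kernel M \<H> \<epsilon> \<longleftrightarrow>
     (\<forall>H\<in>\<H>. (\<lambda>x. \<epsilon> H x) \<in> borel_measurable M) \<and>
     (\<forall>x\<in>space M. E_measure \<H> (\<lambda>H. \<epsilon> H x))"

definition valid_kernel ::
  "'a measure set set \<Rightarrow> ('a measure set \<Rightarrow> 'a \<Rightarrow> ennreal) \<Rightarrow> bool" where
  "valid_kernel \<H> \<epsilon> \<longleftrightarrow> (\<forall>H\<in>\<H>. H \<noteq> {} \<longrightarrow> (\<forall>P\<in>H. (\<integral>\<^sup>+ x. \<epsilon> H x \<partial>P) \<le> 1))"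

end

theory Submission
  imports Defs
begin

text \<open>
  On an intersection-closed hypothesis space the closure of a decreasing set function \<open>\<phi>\<close> is
  \<open>H \<mapsto> (INF P\<in>H. \<phi> H\<^sub>P)\<close>: the family of least hypotheses of the members of \<open>H\<close> is the finest
  cover of \<open>H\<close>, and it attains the supremum. By assumption this infimum has only countably many
  distinct terms, which gives measurability, and bounding it by the single term of \<open>P\<close> gives the
  integral bound.
\<close>

lemma least_hypothesis_mem: "P \<in> least_hypothesis \<H> P"
  by (simp add: least_hypothesis_def)

lemma least_hypothesis_subset: "H \<in> \<H> \<Longrightarrow> P \<in> H \<Longrightarrow> least_hypothesis \<H> P \<subseteq> H"
  by (auto simp: least_hypothesis_def)

text \<open>Closure under intersections is available for nonempty families only;
  \<open>\<P> \<in> \<H>\<close> puts \<open>\<P>\<close> itself into the family that is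
  intersected.\<close>

lemma least_hypothesis_in_class:
  assumes "intersection_closed \<P> \<H>" and "P \<in> \<P>"
  shows "least_hypothesis \<H> P \<in> \<H>"
proof -
  have "{H \<in> \<H>. P \<in> H} \<subseteq> \<H>" "{H \<in> \<H>. P \<in> H} \<noteq> {}"
    using assms by (auto simp: intersection_closed_def)
  with assms(1) show ?thesis
    unfolding intersection_closed_def least_hypothesis_def by blast
qed

text \<open>In any cover of \<open>H\<close>, the member around a given \<open>P\<close> includes
  the least hypothesis of \<open>P\<close>, so antitonicity puts its value below the term of
  \<open>P\<close>. Conversely, each \<open>P\<close> lies in its own least hypothesis, so these
  sets form an admissible cover.\<close>

lemma E_closure_eq_INF_least_hypothesis:
  fixes \<phi> :: "'a measure set \<Rightarrow> ennreal"
  assumes ic: "intersection_closed \<P> \<H>" and "H \<subseteq> \<P>"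
    and anti: "\<And>H H'. H \<in> \<H> \<Longrightarrow> H' \<in> \<H> \<Longrightarrow> H \<subseteq> H' \<Longrightarrow> \<phi> H' \<le> \<phi> H"
  shows "E_closure \<H> \<phi> H = (INF P\<in>H. \<phi> (least_hypothesis \<H> P))"
proof (rule antisym)
  have lh: "least_hypothesis \<H> P \<in> \<H>" if "P \<in> H" for P
    using least_hypothesis_in_class[OF ic] that \<open>H \<subseteq> \<P>\<close> by blast
  show "E_closure \<H> \<phi> H \<le> (INF P\<in>H. \<phi> (least_hypothesis \<H> P))"
    unfolding E_closure_def
  proof (intro SUP_least INF_greatest)
    fix \<T> P assume T: "\<T> \<in> {\<T>. \<T> \<subseteq> \<H> \<and> H \<subseteq> \<Union>\<T>}" and P: "P \<in> H"
    then obtain H' where H': "H' \<in> \<T>" "H' \<in> \<H>" "P \<in> H'" by blast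
    have "\<phi> H' \<le> \<phi> (least_hypothesis \<H> P)"
      using anti[OF lh[OF P] H'(2)] least_hypothesis_subset[OF H'(2,3)] by blast
    with H'(1) show "(INF H'\<in>\<T>. \<phi> H') \<le> \<phi> (least_hypothesis \<H> P)"
      by (rule INF_lower2)
  qed
  have "least_hypothesis \<H> ` H \<in> {\<T>. \<T> \<subseteq> \<H> \<and> H \<subseteq> \<Union>\<T>}"
    using lh least_hypothesis_mem by fast
  then have "(INF H'\<in>least_hypothesis \<H> ` H. \<phi> H') \<le> E_closure \<H> \<phi> H"
    unfolding E_closure_def by (rule SUP_upper)
  then show "(INF P\<in>H. \<phi> (least_hypothesis \<H> P)) \<le> E_closure \<H> \<phi> H"
    by (simp add: image_image)
qed

theorem proposition8:
  fixes M :: "'a measure"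
    and \<P> :: "'a measure set"
    and \<H> :: "'a measure set set"
    and \<epsilon>\<^sub>0 :: "'a measure set \<Rightarrow> ennreal"
    and \<epsilon>\<^sub>1 \<epsilon>\<^sub>2 :: "'a measure set \<Rightarrow> 'a \<Rightarrow> ennreal"
  assumes "hypothesis_space M \<P> \<H>"
    and "intersection_closed \<P> \<H>"
    and "countable (least_hypothesis \<H> ` \<P>)"
    and "E_capacity \<H> \<epsilon>\<^sub>0"
    and "E_capacity_kernel M \<H> \<epsilon>\<^sub>1"
    and "valid_kernel \<H> \<epsilon>\<^sub>1"
    and "\<And>x H. x \<in> space M \<Longrightarrow> H \<in> \<H> \<Longrightarrow>
           \<epsilon>\<^sub>2 H x = E_closure \<H> (\<lambda>H'. \<epsilon>\<^sub>0 H' * \<epsilon>\<^sub>1 H' x) H"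
  shows "E_measure_kernel M \<H> \<epsilon>\<^sub>2 \<and>
         (\<forall>H\<in>\<H>. H \<noteq> {} \<longrightarrow>
            (\<forall>P\<in>H. (\<integral>\<^sup>+ x. \<epsilon>\<^sub>2 H x \<partial>P) \<le> \<epsilon>\<^sub>0 (least_hypothesis \<H> P)))"
proof (intro conjI ballI impI)
  have H_sub: "H \<subseteq> \<P>" if "H \<in> \<H>" for H
    using assms(1) that by (simp add: hypothesis_space_def)
  have meas1: "\<epsilon>\<^sub>1 H \<in> borel_measurable M" if "H \<in> \<H>" for H
    using assms(5) that by (simp add: E_capacity_kernel_def)
  let ?L = "least_hypothesis \<H>"
  have L: "?L P \<in> \<H>" if "H \<in> \<H>" "P \<in> H" for H P
    using least_hypothesis_in_class[OF assms(2)] H_sub that by blast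
  \<comment> \<open>For fixed \<open>x\<close> the product of two antitone functions is antitone,
    also with \<open>0 * \<infinity> = 0\<close>, so the formula for the closure applies.\<close>
  have eps2: "\<epsilon>\<^sub>2 H x = (INF P\<in>H. \<epsilon>\<^sub>0 (?L P) * \<epsilon>\<^sub>1 (?L P) x)"
    if "x \<in> space M" "H \<in> \<H>" for x H
    unfolding assms(7)[OF that]
  proof (rule E_closure_eq_INF_least_hypothesis[OF assms(2) H_sub[OF that(2)]])
    fix H H' assume "H \<in> \<H>" "H' \<in> \<H>" "H \<subseteq> H'"
    then have "\<epsilon>\<^sub>0 H' \<le> \<epsilon>\<^sub>0 H" "\<epsilon>\<^sub>1 H' x \<le> \<epsilon>\<^sub>1 H x"
      using assms(4,5) that(1) by (simp_all add: E_capacity_kernel_def E_capacity_def)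
    then show "\<epsilon>\<^sub>0 H' * \<epsilon>\<^sub>1 H' x \<le> \<epsilon>\<^sub>0 H * \<epsilon>\<^sub>1 H x"
      by (simp add: mult_mono)
  qed
  show "E_measure_kernel M \<H> \<epsilon>\<^sub>2"
    unfolding E_measure_kernel_def E_measure_def
  proof (intro conjI ballI allI impI)
    fix H assume H: "H \<in> \<H>"
    \<comment> \<open>\<open>H\<close> may be uncountable, so the infimum is indexed by the distinct
      least hypotheses instead of by the points of \<open>H\<close>.\<close>
    have "countable (?L ` H)"
      using assms(3) by (rule countable_subset[rotated]) (use H_sub[OF H] in blast)
    moreover have "(\<lambda>x. \<epsilon>\<^sub>0 K * \<epsilon>\<^sub>1 K x) \<in> borel_measurable M" if "K \<in> ?L ` H" for K
      using that L[OF H] meas1 by (intro borel_measurable_times_ennreal) auto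
    ultimately have "(\<lambda>x. INF K\<in>?L ` H. \<epsilon>\<^sub>0 K * \<epsilon>\<^sub>1 K x) \<in> borel_measurable M"
      by (rule borel_measurable_INF)
    then show "\<epsilon>\<^sub>2 H \<in> borel_measurable M"
      by (rule measurable_cong[THEN iffD1, rotated]) (simp add: eps2 H image_image)
  next
    fix x \<S> assume x: "x \<in> space M" and S: "\<S> \<subseteq> \<H>"
    then have "\<Union>\<S> \<in> \<H>"
      using assms(1) by (simp add: hypothesis_space_def)
    with x have "\<epsilon>\<^sub>2 (\<Union>\<S>) x = (INF P\<in>\<Union>\<S>. \<epsilon>\<^sub>0 (?L P) * \<epsilon>\<^sub>1 (?L P) x)"
      by (rule eps2)
    \<comment> \<open>The term of \<open>P\<close> does not depend on the hypothesis containing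
      \<open>P\<close>, so the infimum over a union splits. For empty \<open>\<S>\<close> both sides
      are \<open>\<infinity>\<close>.\<close>
    also have "\<dots> = (INF H\<in>\<S>. INF P\<in>H. \<epsilon>\<^sub>0 (?L P) * \<epsilon>\<^sub>1 (?L P) x)"
      by (rule antisym) (blast intro: INF_greatest INF_lower INF_lower2)+
    also have "\<dots> = (INF H\<in>\<S>. \<epsilon>\<^sub>2 H x)"
      using x S by (intro INF_cong refl eps2[symmetric]) auto
    finally show "\<epsilon>\<^sub>2 (\<Union>\<S>) x = (INF H\<in>\<S>. \<epsilon>\<^sub>2 H x)" .
  qed
  fix H P assume H: "H \<in> \<H>" and P: "P \<in> H"
  have sets: "sets P = sets M"
    using assms(1) H_sub[OF H] P by (auto simp: hypothesis_space_def)
  have meas: "\<epsilon>\<^sub>1 (?L P) \<in> borel_measurable P"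
    unfolding measurable_cong_sets[OF sets refl] using L[OF H P] by (rule meas1)
  \<comment> \<open>Validity is used at the least hypothesis of \<open>P\<close>, which is nonempty
    because it contains \<open>P\<close>, and not at \<open>H\<close>.\<close>
  have valid: "(\<integral>\<^sup>+ x. \<epsilon>\<^sub>1 (?L P) x \<partial>P) \<le> 1"
    using assms(6) L[OF H P] least_hypothesis_mem[of P \<H>]
    unfolding valid_kernel_def by blast
  have "(\<integral>\<^sup>+ x. \<epsilon>\<^sub>2 H x \<partial>P) \<le> (\<integral>\<^sup>+ x. \<epsilon>\<^sub>0 (?L P) * \<epsilon>\<^sub>1 (?L P) x \<partial>P)"
    using H P sets_eq_imp_space_eq[OF sets]
    by (intro nn_integral_mono) (auto simp: eps2 intro: INF_lower)
  \<comment> \<open>The constant may be \<open>\<infinity>\<close>: it still factors out, and if the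
    integral is 0 the product is 0.\<close>
  also have "\<dots> = \<epsilon>\<^sub>0 (?L P) * (\<integral>\<^sup>+ x. \<epsilon>\<^sub>1 (?L P) x \<partial>P)"
    using meas by (rule nn_integral_cmult)
  also have "\<dots> \<le> \<epsilon>\<^sub>0 (?L P)"
    using mult_left_mono[OF valid, of "\<epsilon>\<^sub>0 (?L P)"] by simp
  finally show "(\<integral>\<^sup>+ x. \<epsilon>\<^sub>2 H x \<partial>P) \<le> \<epsilon>\<^sub>0 (?L P)" .
qed

end
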